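(* Let $d\ge2$ and $K\ge2$ be integers. For either $\lambda_0\in\{-2d,2d\}$, there exist a potential $V$ on $\mathbb Z^d$ supported on exactly $K$ sites (i.e. $V(n)\ne0$ for exactly $K$ points $n\in\mathbb Z^d$), a nonzero function $u$ on $\mathbb Z^d$, and a constant $C>0$ such that $$(\Delta+V)u=\lambda_0u$$ and $$|u(n)|\le C\langle n\rangle^{-(d+K-3)}\qquad\text{for all }n\in\mathbb Z^d.$$
   Context: For $n\in\mathbb Z^d$, $|n|=(n_1^2+\cdots+n_d^2)^{1/2}$ and $\langle n\rangle=(1+|n|^2)^{1/2}$. $\Delta$ is the (uncentered) nearest-neighbor adjacency operator $(\Delta u)(n)=\sum_{j=1}^d\bigl(u(n+e_j)+u(n-e_j)\bigr)$, with $e_1,\dots,e_d$ the standard basis vectors. A potential is a function $V:\mathbb Z^d\to\mathbb C$ acting by multiplication: $(Vu)(n)=V(n)u(n)$. *)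

theory Defs
  imports "HOL-Analysis.Analysis"
begin

definition adjacency :: "(int ^ 'd \<Rightarrow> complex) \<Rightarrow> int ^ 'd \<Rightarrow> complex" where
  "adjacency u n = (\<Sum>j\<in>UNIV. u (n + axis j 1) + u (n - axis j 1))"

definition mult_op :: "(int ^ 'd \<Rightarrow> complex) \<Rightarrow> (int ^ 'd \<Rightarrow> complex) \<Rightarrow> int ^ 'd \<Rightarrow> complex" where
  "mult_op V u n = V n * u n"

text \<open>The type \<^typ>\<open>int\<close> is not a normed vector space in the library, so the Euclidean norm
  on the lattice is written out by coordinates.\<close>

definition lattice_norm :: "int ^ 'd \<Rightarrow> real" where
  "lattice_norm n = sqrt (\<Sum>j\<in>UNIV. (real_of_int (n $ j))\<^sup>2)"

definition bracket :: "int ^ 'd \<Rightarrow> real" where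
  "bracket n = sqrt (1 + (lattice_norm n)\<^sup>2)"

end

(* Let p_t be the kernel of the continuous-time heat semigroup on Z^d, which is a product of
   one-dimensional kernels q_t, and put N = K - 1. Integrating the N-th difference of p_t in one
   coordinate direction over t > 0 gives a function U with (Delta - 2d) U = - F, where F consists of
   the signed binomial coefficients on N + 1 = K consecutive sites of a line; hence V = F / U
   works once U does not vanish on these sites.

   Decay: q_t(m) is the mean of z^m exp(t (z + 1/z - 2)) over a circle of any radius. The radius
   exp(+-1/sqrt(1 + t)) gives the bound O(s^(-(N+1)/2) exp(-|m| / sqrt s)), s = 1 + t, for the N-th
   difference, and integrating the product of these bounds over t gives |n|^(-(d+N-2)).

   Non-vanishing: (-1)^j U > 0 at the j-th site. By Pascal's rule the interior sites follow by
   induction on N, and a reflection exchanges the two end sites. At the end site, q_t(0)^(d-1) is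
   a mixture of exponentials exp(-s t), and for each s > 0 the Laplace transform of q_t(m) is a
   geometric sequence r^|m|, whose N-th difference at 0 is proportional to (1 - r)^N > 0.

   The case of -2d follows by the sign change (-1)^(n_1 + ... + n_d). *)

theory Submission
  imports Defs "HOL-Complex_Analysis.Complex_Analysis"
begin

section \<open>The one-dimensional heat kernel and its differences\<close>

text \<open>This is exp (- 2 t) I_m(2 t) with the modified Bessel function I_m: the m-th Fourier
  coefficient of the heat multiplier, so that it solves q' = q(m+1) + q(m-1) - 2 q(m) from a unit
  mass at 0.\<close>

definition heat_kernel :: "real \<Rightarrow> int \<Rightarrow> real" where
  "heat_kernel t m =
     integral {0..1} (\<lambda>x. cos (2 * pi * m * x) * exp (- 2 * t * (1 - cos (2 * pi * x))))"

text \<open>Backward differences, so that the initial datum at t = 0 occupies the sites 0, ...,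
  N.\<close>

fun heat_diff :: "nat \<Rightarrow> real \<Rightarrow> int \<Rightarrow> real" where
  "heat_diff 0 t m = heat_kernel t m"
| "heat_diff (Suc N) t m = heat_diff N t m - heat_diff N t (m - 1)"

text \<open>The Fourier integrand continued from the unit circle to all nonzero z; each backward
  difference contributes a factor 1 - 1/z.\<close>

definition heat_symbol :: "nat \<Rightarrow> real \<Rightarrow> int \<Rightarrow> complex \<Rightarrow> complex" where
  "heat_symbol N t m z = z powi m * (1 - inverse z) ^ N * exp (of_real t * (z + inverse z - 2))"

text \<open>The mean of g over a circle about 0 is the contour integral of g(z)/z divided by 2 pi i,
  which is the residue at 0 for every radius.\<close>

lemma circle_mean_independent_of_radius:
  assumes "g holomorphic_on - {0}"
  obtains c where "\<And>r. r > 0 \<Longrightarrow> ((\<lambda>x. g (of_real r * cis (2 * pi * x))) has_integral c) {0..1}"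
proof
  fix r :: real assume r: "r > 0"
  define f where "f z = g z / z" for z
  have "f holomorphic_on UNIV - {0}"
    unfolding f_def using assms by (intro holomorphic_intros) (auto simp: Compl_eq_Diff_UNIV)
  then have "(f has_contour_integral 2 * pi * \<i> * residue f 0) (circlepath 0 r)"
    using r by (intro base_residue[of UNIV]) auto
  then have "((\<lambda>x. f (circlepath 0 r x) * vector_derivative (circlepath 0 r) (at x))
      has_integral 2 * pi * \<i> * residue f 0) {0..1}"
    by (simp add: has_contour_integral)
  moreover have "f (circlepath 0 r x) * vector_derivative (circlepath 0 r) (at x)
      = 2 * pi * \<i> * g (of_real r * cis (2 * pi * x))" for x
    using r by (simp add: f_def vector_derivative_circlepath) (simp add: circlepath cis_conv_exp mult_ac)
  ultimately have "((\<lambda>x. 2 * pi * \<i> * g (of_real r * cis (2 * pi * x)))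
      has_integral 2 * pi * \<i> * residue f 0) {0..1}"
    by simp
  from has_integral_mult_right[OF this, of "inverse (2 * pi * \<i>)"]
  show "((\<lambda>x. g (of_real r * cis (2 * pi * x))) has_integral residue f 0) {0..1}"
    by (simp add: field_simps)
qed

lemma heat_symbol_holomorphic: "heat_symbol N t m holomorphic_on - {0}"
  unfolding heat_symbol_def[abs_def] by (intro holomorphic_intros) auto

lemma heat_symbol_Suc:
  "z \<noteq> 0 \<Longrightarrow> heat_symbol (Suc N) t m z = heat_symbol N t m z - heat_symbol N t (m - 1) z"
  by (simp add: heat_symbol_def power_int_diff field_simps)

lemma heat_symbol_cis:
  "heat_symbol 0 t m (cis y) = cis (m * y) * of_real (exp (- 2 * t * (1 - cos y)))"
proof -
  have "cis y + inverse (cis y) - 2 = of_real (2 * cos y - 2)"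
    by (simp add: complex_eq_iff)
  then have "of_real t * (cis y + inverse (cis y) - 2) = of_real (- 2 * t * (1 - cos y))"
    by (simp only: of_real_mult[symmetric]) (simp add: algebra_simps)
  then show ?thesis
    by (simp only: heat_symbol_def cis_power_int exp_of_real) simp
qed

text \<open>One value \<open>c\<close> serves all radii, so the radius may be chosen later depending
  on t and m. Only \<open>Re c\<close> is identified because \<open>heat_kernel\<close> is defined
  with a cosine.\<close>

lemma heat_diff_circle_mean:
  obtains c where "Re c = heat_diff N t m"
    "\<And>r. r > 0 \<Longrightarrow> ((\<lambda>x. heat_symbol N t m (of_real r * cis (2 * pi * x))) has_integral c) {0..1}"
proof -
  have "\<exists>c. Re c = heat_diff N t m \<and>
     (\<forall>r>0. ((\<lambda>x. heat_symbol N t m (of_real r * cis (2 * pi * x))) has_integral c) {0..1})"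
  proof (induction N arbitrary: m)
    case 0
    obtain c where c: "\<And>r. r > 0 \<Longrightarrow>
        ((\<lambda>x. heat_symbol 0 t m (of_real r * cis (2 * pi * x))) has_integral c) {0..1}"
      using circle_mean_independent_of_radius[OF heat_symbol_holomorphic] by metis
    have "((\<lambda>x. Re (heat_symbol 0 t m (cis (2 * pi * x)))) has_integral Re c) {0..1}"
      using has_integral_Re[OF c[of 1]] by simp
    then have "Re c = heat_kernel t m"
      unfolding heat_kernel_def heat_symbol_cis
      by (intro integral_unique[symmetric]) (simp add: mult_ac)
    then show ?case using c by auto
  next
    case (Suc N)
    obtain c1 where c1: "Re c1 = heat_diff N t m" "\<And>r. r > 0 \<Longrightarrow>
        ((\<lambda>x. heat_symbol N t m (of_real r * cis (2 * pi * x))) has_integral c1) {0..1}"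
      using Suc.IH[of m] by auto
    obtain c2 where c2: "Re c2 = heat_diff N t (m - 1)" "\<And>r. r > 0 \<Longrightarrow>
        ((\<lambda>x. heat_symbol N t (m - 1) (of_real r * cis (2 * pi * x))) has_integral c2) {0..1}"
      using Suc.IH[of "m - 1"] by auto
    have "((\<lambda>x. heat_symbol (Suc N) t m (of_real r * cis (2 * pi * x)))
        has_integral (c1 - c2)) {0..1}" if "r > 0" for r
      using has_integral_diff[OF c1(2) c2(2), OF that that] that
      by (subst heat_symbol_Suc) auto
    then show ?case using c1 c2 by (intro exI[of _ "c1 - c2"]) auto
  qed
  then show ?thesis using that by blast
qed

section \<open>Elementary inequalities and the pointwise bound for the kernel differences\<close>

lemma power_le_fact_exp: "y ^ k \<le> fact k * exp y" if "y \<ge> 0" for y :: real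
proof -
  have "(\<Sum>n\<in>{k}. y ^ n /\<^sub>R fact n) \<le> exp y"
    unfolding exp_def by (rule sum_le_suminf[OF summable_exp_generic]) (use that in auto)
  then show ?thesis by (simp add: field_simps)
qed

lemma cosh_minus_one_le: "cosh a - 1 \<le> a\<^sup>2" if "0 \<le> a" "a \<le> 1" for a :: real
proof -
  \<comment> \<open>The quadratic lower bound for exp a, inverted, gives an upper bound for exp (-a)
    whose linear term cancels against that of exp a in the sum.\<close>
  have "1 \<le> 1 + a\<^sup>2 / 2 + a ^ 3 / 2 + a ^ 4 / 2" using that by simp
  also have "\<dots> = (1 - a + a\<^sup>2) * (1 + a + a\<^sup>2 / 2)"
    by (simp add: field_simps power2_eq_square power3_eq_cube power4_eq_xxxx)
  also have "\<dots> \<le> (1 - a + a\<^sup>2) * exp a"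
    using that by (intro mult_left_mono exp_lower_Taylor_quadratic) auto
  finally have "exp (- a) \<le> 1 - a + a\<^sup>2" by (simp add: exp_minus field_simps)
  moreover have "exp a \<le> 1 + a + a\<^sup>2" using exp_bound that by blast
  ultimately have "exp a + exp (- a) \<le> 2 * (1 + a\<^sup>2)" by simp
  then have "(exp a + exp (- a)) / 2 \<le> 1 + a\<^sup>2" by (subst divide_le_eq) (simp add: mult.commute)
  then show ?thesis unfolding cosh_field_def diff_le_eq by (simp only: add.commute)
qed

lemma norm_one_minus_cis: "norm (1 - cis y) = 2 * \<bar>sin (y / 2)\<bar>"
proof -
  have "(norm (1 - cis y))\<^sup>2 = 2 - 2 * cos y"
    by (simp add: cmod_power2 power2_diff)
  also have "\<dots> = (2 * \<bar>sin (y / 2)\<bar>)\<^sup>2"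
    using cos_double_sin[of "y / 2"] by (simp add: power_mult_distrib)
  finally show ?thesis by (subst (asm) power2_eq_iff_nonneg) auto
qed

lemma has_integral_inverse_one_plus_square:
  assumes "c > 0"
  shows "((\<lambda>x::real. 1 / (1 + (c * x)\<^sup>2)) has_integral arctan c / c) {0..1}"
proof -
  have "((\<lambda>x. arctan (c * x) / c) has_real_derivative 1 / (1 + (c * x)\<^sup>2)) (at x within {0..1})" for x
    using assms by (auto intro!: derivative_eq_intros simp: divide_inverse)
  then have "((\<lambda>x. 1 / (1 + (c * x)\<^sup>2)) has_integral (arctan (c * 1) / c - arctan (c * 0) / c)) {0..1}"
    by (intro fundamental_theorem_of_calculus)
       (auto simp: has_real_derivative_iff_has_vector_derivative[symmetric])
  then show ?thesis by simp
qed

lemma abs_sin_pi_ge: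
  assumes "0 \<le> x" "x \<le> 1"
  shows "min x (1 - x) \<le> \<bar>sin (pi * x)\<bar>"
proof -
  have *: "y \<le> sin (pi * y)" if "0 \<le> y" "y \<le> 1 / 2" for y
  proof -
    define u where "u = pi * y"
    \<comment> \<open>From u <= 2 follows sin u >= u - u^3/6 >= u/3, and u >= 3 y closes the
      estimate; hence only 3 < pi < 4 is needed.\<close>
    have u: "3 * y \<le> u" "u \<le> 2 * 1" "0 \<le> u"
      using that pi_gt3 pi_less_4 mult_mono[of pi 4 y "1/2"] mult_right_mono[of 3 pi y] by (auto simp: u_def)
    have "\<bar>sin u - (\<Sum>m<3. sin_coeff m * u ^ m)\<bar> \<le> inverse (fact 3) * \<bar>u\<bar> ^ 3"
      by (rule Maclaurin_sin_bound)
    then have "u - u ^ 3 / 6 \<le> sin u"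
      using u abs_ge_minus_self[of "sin u - u"]
      by (simp add: numeral_3_eq_3 sin_coeff_def fact_numeral)
    moreover have "u ^ 3 \<le> 2\<^sup>2 * u"
      using u mult_right_mono[of "u\<^sup>2" "2\<^sup>2" u] power_mono[of u 2 2] by (simp add: power3_eq_cube power2_eq_square)
    ultimately show ?thesis using u by (simp add: u_def)
  qed
  show ?thesis
  proof (cases "x \<le> 1 / 2")
    case True then show ?thesis using *[of x] assms by auto
  next
    case False
    have "sin (pi * (1 - x)) = sin (pi * x)" by (simp add: right_diff_distrib)
    then show ?thesis using *[of "1 - x"] assms False by auto
  qed
qed

text \<open>The radius differs from 1 by the diffusive scale \<open>a\<close>, inward for m >= 0 and
  outward for m < 0, so that |z^m| decays in |m| on both sides. The shift is small enough to cost
  the exponential factor only a bounded amount.\<close>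

lemma heat_symbol_norm_le:
  fixes t x :: real and m :: int
  assumes "t \<ge> 0"
  defines "a \<equiv> 1 / sqrt (1 + t)" and "s \<equiv> \<bar>sin (pi * x)\<bar>"
  defines "b \<equiv> (if m \<ge> 0 then - a else a)"
  shows "norm (heat_symbol N t m (of_real (exp b) * cis (2 * pi * x)))
    \<le> exp (- a * \<bar>m\<bar>) * (2 * a + 6 * s) ^ N * exp (6 - 4 * (s / a)\<^sup>2)"
proof -
  define z where "z = of_real (exp b) * cis (2 * pi * x)"
  have a: "0 < a" "a \<le> 1" "a\<^sup>2 * (1 + t) = 1"
    using assms(1) by (auto simp: a_def power_divide)
  have s: "0 \<le> s" "s \<le> 1" "s\<^sup>2 \<le> 1"
    by (auto simp: s_def abs_le_square_iff[of _ 1, simplified, symmetric])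
  have b: "\<bar>b\<bar> = a" using a by (auto simp: b_def)
  have invz: "inverse z = of_real (exp (- b)) * cis (- (2 * pi * x))"
    by (simp add: z_def exp_minus)
  have "norm (z powi m) = exp (- a * \<bar>m\<bar>)"
    by (auto simp: z_def norm_power_int norm_mult exp_power_int b_def abs_if mult_ac)
  moreover have "norm (1 - inverse z) \<le> 2 * a + 6 * s"
  proof -
    have e: "exp a \<le> 1 + a + a\<^sup>2" using a by (intro exp_bound) auto
    have a2: "a\<^sup>2 \<le> a" using a by (simp add: power2_eq_square mult_left_le)
    have "1 - inverse z = of_real (1 - exp (- b)) + of_real (exp (- b)) * (1 - cis (- (2 * pi * x)))"
      by (simp add: invz algebra_simps)
    also have "norm \<dots> \<le> \<bar>1 - exp (- b)\<bar> + exp (- b) * (2 * s)"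
      by (rule order.trans[OF norm_triangle_ineq])
         (simp only: norm_mult norm_of_real norm_one_minus_cis s_def, simp)
    also have "\<bar>1 - exp (- b)\<bar> \<le> 2 * a"
      using e a2 a exp_ge_add_one_self[of "-a"] by (auto simp: b_def)
    also have "exp (- b) \<le> exp a" using b by (auto simp: abs_le_iff)
    also have "exp a \<le> 3" using e a2 a by linarith
    finally show ?thesis using s by (simp add: mult_right_mono)
  qed
  moreover have "norm (exp (of_real t * (z + inverse z - 2))) \<le> exp (6 - 4 * (s / a)\<^sup>2)"
  proof -
    have "cosh b = cosh a" using b by (metis cosh_real_abs)
    moreover have "Re z = exp b * cos (2 * pi * x)" "Re (inverse z) = exp (- b) * cos (2 * pi * x)"
      unfolding invz by (simp_all add: z_def)
    ultimately have "Re (z + inverse z - 2) = 2 * cosh a * cos (2 * pi * x) - 2"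
      by (simp add: cosh_field_def[of b] algebra_simps flip: \<open>cosh b = cosh a\<close>)
    also have "cos (2 * pi * x) = 1 - 2 * s\<^sup>2"
      using cos_double_sin[of "pi * x"] by (simp add: s_def mult_ac)
    also have "2 * cosh a * (1 - 2 * s\<^sup>2) - 2 = 2 * (cosh a - 1) - cosh a * (4 * s\<^sup>2)"
      by (simp add: algebra_simps)
    also have "\<dots> \<le> 2 * a\<^sup>2 - 1 * (4 * s\<^sup>2)"
      using a cosh_minus_one_le[of a] mult_right_mono[OF cosh_real_ge_1[of a], of "4 * s\<^sup>2"] by simp
    finally have "t * Re (z + inverse z - 2) \<le> t * (2 * a\<^sup>2 - 4 * s\<^sup>2)"
      using assms(1) by (intro mult_left_mono) auto
    \<comment> \<open>Since \<open>a\<^sup>2 * (1 + t) = 1\<close>, the first term is at most 2;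
      replacing t by 1 + t in the second costs at most 4. Together these give the constant
      6.\<close>
    also have "\<dots> = 2 * (a\<^sup>2 * (1 + t) - a\<^sup>2) + 4 * s\<^sup>2 - 4 * (s\<^sup>2 * (1 + t))"
      by (simp add: algebra_simps)
    also have "s\<^sup>2 * (1 + t) = (s / a)\<^sup>2"
      using assms(1) by (simp add: a_def power_mult_distrib)
    finally have "t * Re (z + inverse z - 2) \<le> 6 - 4 * (s / a)\<^sup>2"
      using s(3) zero_le_power2[of a] unfolding a(3) by argo
    then show ?thesis by simp
  qed
  ultimately show ?thesis
    unfolding z_def[symmetric] heat_symbol_def norm_mult norm_power
    by (intro mult_mono power_mono) (use a s in auto)
qed

text \<open>The right-hand side has an elementary antiderivative, so the Gaussian never has to be
  integrated.\<close>

lemma gaussian_le_lorentzian: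
  fixes y :: real
  assumes "y \<ge> 0"
  shows "(2 + 6 * y) ^ N * exp (6 - 4 * y\<^sup>2) \<le> 6 ^ N * fact (N + 2) * exp 8 / (1 + y\<^sup>2)"
proof -
  have "(2 + 6 * y) ^ N * (1 + y\<^sup>2) \<le> (6 * (1 + y)) ^ N * (1 + y)\<^sup>2"
    using assms by (intro mult_mono power_mono) (auto simp: power2_sum)
  also have "\<dots> = 6 ^ N * (1 + y) ^ (N + 2)"
    by (simp only: power_add power_mult_distrib mult_ac)
  also have "\<dots> \<le> 6 ^ N * (fact (N + 2) * exp (1 + y))"
    using assms by (intro mult_left_mono power_le_fact_exp) auto
  \<comment> \<open>This is (y - 1/2)^2 >= 0 with room to spare; the right exponent adds up to 8
    with 6 - 4 y^2.\<close>
  also have "exp (1 + y) \<le> exp (2 + 4 * y\<^sup>2)"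
    using assms zero_le_power2[of "y - 1/2"] by (simp add: power2_diff field_simps) 
  also have "exp (2 + 4 * y\<^sup>2) = exp 8 / exp (6 - 4 * y\<^sup>2)"
    by (simp add: exp_diff[symmetric])
  finally have "(2 + 6 * y) ^ N * (1 + y\<^sup>2) * exp (6 - 4 * y\<^sup>2) \<le> 6 ^ N * fact (N + 2) * exp 8"
    by (simp add: pos_le_divide_eq del: fact_Suc)
  moreover have "1 + y\<^sup>2 > 0" by (simp add: add_pos_nonneg)
  ultimately show ?thesis by (simp add: pos_le_divide_eq mult_ac del: fact_Suc)
qed

text \<open>In the variable y = |sin (pi x)| / a the N difference factors yield
  \<open>a ^ N\<close>, and integrating a Lorentzian of width about \<open>a\<close> yields one more
  power of \<open>a\<close>.\<close>

lemma heat_diff_bound: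
  obtains C where "C > 0" "\<And>t m. t \<ge> 0 \<Longrightarrow>
    \<bar>heat_diff N t m\<bar> \<le> C * (1 / sqrt (1 + t)) ^ Suc N * exp (- (1 / sqrt (1 + t)) * \<bar>m\<bar>)"
proof
  define D :: real where "D = 6 ^ N * fact (N + 2) * exp 8"
  have D: "D > 0" by (simp add: D_def)
  then show "4 * D > 0" by simp
  fix t :: real and m :: int assume t: "t \<ge> 0"
  define a where "a = 1 / sqrt (1 + t)"
  define b where "b = (if m \<ge> 0 then - a else a)"
  have a: "0 < a" using t by (simp add: a_def)
  obtain c where c: "Re c = heat_diff N t m"
    "((\<lambda>x. heat_symbol N t m (of_real (exp b) * cis (2 * pi * x))) has_integral c) {0..1}"
    using heat_diff_circle_mean exp_gt_zero by metis
  define E where "E = D * a ^ N * exp (- a * \<bar>m\<bar>)"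
  have "((\<lambda>x. 1 / (1 + (1 / a * x)\<^sup>2)) has_integral arctan (1 / a) / (1 / a)) {0..1}"
    using a by (intro has_integral_inverse_one_plus_square) auto
  \<comment> \<open>On {0..1} the symbol concentrates at both endpoints, which are the same point of
    the circle; the mirrored Lorentzian covers the endpoint 1.\<close>
  moreover from has_integral_affinity[OF this[folded cbox_interval], of "-1" 1]
  have "((\<lambda>x. 1 / (1 + (1 / a * (1 - x))\<^sup>2)) has_integral arctan (1 / a) / (1 / a)) {0..1}"
    by (simp add: image_affinity_cbox)
  ultimately have *: "((\<lambda>x. E * (1 / (1 + (1 / a * x)\<^sup>2) + 1 / (1 + (1 / a * (1 - x))\<^sup>2)))
      has_integral E * (arctan (1 / a) / (1 / a) + arctan (1 / a) / (1 / a))) {0..1}"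
    by (intro has_integral_mult_right has_integral_add)
  have "norm (integral {0..1} (\<lambda>x. heat_symbol N t m (of_real (exp b) * cis (2 * pi * x))))
    \<le> integral {0..1} (\<lambda>x. E * (1 / (1 + (1 / a * x)\<^sup>2) + 1 / (1 + (1 / a * (1 - x))\<^sup>2)))"
  proof (rule integral_norm_bound_integral)
    fix x :: real assume x: "x \<in> {0..1}"
    define y where "y = \<bar>sin (pi * x)\<bar> / a"
    have y: "y \<ge> 0" using a by (simp add: y_def)
    have "norm (heat_symbol N t m (of_real (exp b) * cis (2 * pi * x)))
      \<le> exp (- a * \<bar>m\<bar>) * (2 * a + 6 * \<bar>sin (pi * x)\<bar>) ^ N * exp (6 - 4 * y\<^sup>2)"
      unfolding y_def a_def b_def by (rule heat_symbol_norm_le[OF t])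
    also have "2 * a + 6 * \<bar>sin (pi * x)\<bar> = a * (2 + 6 * y)"
      using a by (simp add: y_def field_simps)
    also have "exp (- a * \<bar>m\<bar>) * (a * (2 + 6 * y)) ^ N * exp (6 - 4 * y\<^sup>2)
        = exp (- a * \<bar>m\<bar>) * a ^ N * ((2 + 6 * y) ^ N * exp (6 - 4 * y\<^sup>2))"
      by (simp add: power_mult_distrib)
    also have "\<dots> \<le> exp (- a * \<bar>m\<bar>) * a ^ N * (D / (1 + y\<^sup>2))"
      unfolding D_def using a y by (intro mult_left_mono gaussian_le_lorentzian) auto
    also have "\<dots> = E * (1 / (1 + y\<^sup>2))" by (simp add: E_def)
    also have "1 / (1 + y\<^sup>2) \<le> 1 / (1 + (1 / a * min x (1 - x))\<^sup>2)"
    proof -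
      have "1 / a * min x (1 - x) \<le> y"
        unfolding y_def using a abs_sin_pi_ge[of x] x by (simp add: divide_right_mono)
      then show ?thesis using x a
        by (intro divide_left_mono add_left_mono power_mono mult_pos_pos add_pos_nonneg) auto
    qed
    also have "\<dots> \<le> 1 / (1 + (1 / a * x)\<^sup>2) + 1 / (1 + (1 / a * (1 - x))\<^sup>2)"
      by (auto simp: min_def)
    finally show "norm (heat_symbol N t m (of_real (exp b) * cis (2 * pi * x)))
      \<le> E * (1 / (1 + (1 / a * x)\<^sup>2) + 1 / (1 + (1 / a * (1 - x))\<^sup>2))"
      using D a by (simp add: E_def)
  qed (use c * in \<open>auto simp: integrable_on_def\<close>)
  then have "norm c \<le> E * (2 * arctan (1 / a) * a)"
    using integral_unique[OF c(2)] integral_unique[OF *] by (simp add: algebra_simps)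
  \<comment> \<open>The bound arctan < pi/2 < 2 is used.\<close>
  also have "\<dots> \<le> E * (2 * 2 * a)"
    using a D arctan_ubound[of "1 / a"] pi_less_4
    by (intro mult_left_mono mult_right_mono) (auto simp: E_def)
  also have "\<dots> = 4 * D * a ^ Suc N * exp (- a * \<bar>m\<bar>)" by (simp add: E_def)
  finally show "\<bar>heat_diff N t m\<bar> \<le> 4 * D * (1 / sqrt (1 + t)) ^ Suc N * exp (- (1 / sqrt (1 + t)) * \<bar>m\<bar>)"
    using abs_Re_le_cmod[of c] c(1) by (simp add: a_def)
qed

section \<open>The heat equation, initial values and symmetry\<close>

lemma heat_kernel_has_derivative:
  "((\<lambda>t. heat_kernel t m) has_real_derivative
     heat_kernel t (m + 1) + heat_kernel t (m - 1) - 2 * heat_kernel t m) (at t)"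
proof -
  define f where "f m t x = cos (2 * pi * real_of_int m * x) * exp (- 2 * t * (1 - cos (2 * pi * x)))"
    for m :: int and t x :: real
  have f_int: "f m t integrable_on {0..1}" for m t
    unfolding f_def by (intro integrable_continuous_interval continuous_intros)
  have "((\<lambda>t. integral (cbox 0 1) (f m t)) has_field_derivative
      integral (cbox 0 1) (\<lambda>x. f m t x * (- 2 * (1 - cos (2 * pi * x))))) (at t within UNIV)"
  proof (rule leibniz_rule_field_derivative)
    show "((\<lambda>t. f m t x) has_real_derivative f m t x * (- 2 * (1 - cos (2 * pi * x)))) (at t within UNIV)"
      for t x unfolding f_def by (auto intro!: derivative_eq_intros)
    show "f m t integrable_on cbox 0 1" for t using f_int by simp
    show "continuous_on (UNIV \<times> cbox 0 1) (\<lambda>(t, x). f m t x * (- 2 * (1 - cos (2 * pi * x))))"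
      unfolding f_def split_beta' by (intro continuous_intros)
  qed auto
  \<comment> \<open>Multiplication by 2 (cos (2 pi x) - 1) on the Fourier side is the second
    difference in m.\<close>
  moreover have "f m t x * (- 2 * (1 - cos (2 * pi * x))) = f (m + 1) t x + f (m - 1) t x - 2 * f m t x" for x
    by (simp add: f_def cos_add cos_diff algebra_simps)
  moreover have K: "integral {0..1} (f m t) = heat_kernel t m" for m t
    by (simp only: heat_kernel_def f_def[abs_def])
  have "((\<lambda>x. f (m + 1) t x + f (m - 1) t x - 2 * f m t x) has_integral
      heat_kernel t (m + 1) + heat_kernel t (m - 1) - 2 * heat_kernel t m) {0..1}"
    unfolding K[symmetric]
    by (intro has_integral_add has_integral_diff has_integral_mult_right integrable_integral f_int)
  ultimately show ?thesis by (simp add: K integral_unique)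
qed

lemma heat_diff_has_derivative:
  "((\<lambda>t. heat_diff N t m) has_real_derivative
     heat_diff N t (m + 1) + heat_diff N t (m - 1) - 2 * heat_diff N t m) (at t)"
proof (induction N arbitrary: m)
  case 0
  show ?case using heat_kernel_has_derivative by simp
next
  case (Suc N)
  show ?case using DERIV_diff[OF Suc.IH[of m] Suc.IH[of "m - 1"]] by (simp add: algebra_simps)
qed

lemma continuous_on_heat_diff [continuous_intros]: "continuous_on A (\<lambda>t. heat_diff N t m)"
  by (rule DERIV_continuous_on, rule has_field_derivative_at_within[OF heat_diff_has_derivative])

lemma heat_kernel_at_0: "heat_kernel 0 m = (if m = 0 then 1 else 0)"
proof (cases "m = 0")
  case False
  have "((\<lambda>x. cos (2 * pi * m * x)) has_integral
      sin (2 * pi * m * 1) / (2 * pi * m) - sin (2 * pi * m * 0) / (2 * pi * m)) {0..1}"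
    using False by (intro fundamental_theorem_of_calculus)
      (auto intro!: derivative_eq_intros simp: has_real_derivative_iff_has_vector_derivative[symmetric])
  moreover have "sin (2 * pi * m) = 0"
    using sin_int_2pin[of m] by (simp add: mult_ac)
  ultimately show ?thesis using False by (simp add: heat_kernel_def integral_unique)
qed (simp add: heat_kernel_def)

text \<open>Pascal's rule. The value is nonzero exactly for 0 <= m <= N, which later yields the K =
  N + 1 sites of the potential.\<close>

lemma heat_diff_at_0:
  "heat_diff N 0 m = (if m \<ge> 0 then (- 1) ^ nat m * real (N choose nat m) else 0)"
proof (induction N arbitrary: m)
  case 0
  show ?case by (cases "m = 0") (auto simp: heat_kernel_at_0 binomial_eq_0)
next
  case (Suc N)
  consider "m < 0" | "m = 0" | j where "m = int (Suc j)"
    using zero_less_imp_eq_int[of m] by (metis Suc_pred linorder_neqE)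
  then show ?case
    by cases (simp_all add: Suc.IH nat_add_distrib algebra_simps)
qed

lemma heat_kernel_uminus: "heat_kernel t (- m) = heat_kernel t m"
  by (simp add: heat_kernel_def)

text \<open>The kernel is even, and reflecting the sites turns each backward difference into its
  negative.\<close>

lemma heat_diff_reflect: "heat_diff N t (int N - m) = (- 1) ^ N * heat_diff N t m"
proof (induction N arbitrary: m)
  case 0
  show ?case by (simp add: heat_kernel_uminus)
next
  case (Suc N)
  have "int (Suc N) - m = int N - (m - 1)" "int (Suc N) - m - 1 = int N - m" by auto
  then show ?case by (simp only: heat_diff.simps Suc.IH) (simp add: algebra_simps)
qed

lemma heat_kernel_0_has_integral:
  "((\<lambda>x. exp (- 2 * t * (1 - cos (2 * pi * x)))) has_integral heat_kernel t 0) {0..1}"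
  unfolding heat_kernel_def
  by (simp, intro integrable_integral integrable_continuous_interval continuous_intros)

lemma heat_kernel_0_pos: "heat_kernel t 0 > 0"
proof -
  have "((\<lambda>x. exp (- 4 * \<bar>t\<bar>)) has_integral exp (- 4 * \<bar>t\<bar>)) {0..1::real}"
    using has_integral_const_real[of "exp (- 4 * \<bar>t\<bar>)" 0 1] by simp
  moreover have "exp (- 4 * \<bar>t\<bar>) \<le> exp (- 2 * t * (1 - cos (2 * pi * x)))" for x :: real
  proof -
    have "t * (1 - cos (2 * pi * x)) \<le> \<bar>t\<bar> * (1 - cos (2 * pi * x))"
      by (intro mult_right_mono) auto
    also have "\<dots> \<le> \<bar>t\<bar> * 2"
      using cos_ge_minus_one[of "2 * pi * x"] by (intro mult_left_mono) auto
    finally show ?thesis by simp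
  qed
  ultimately have "exp (- 4 * \<bar>t\<bar>) \<le> heat_kernel t 0"
    using has_integral_le[OF _ heat_kernel_0_has_integral[of t]] by metis
  then show ?thesis by (rule less_le_trans[OF exp_gt_zero])
qed

section \<open>Integrals over the time half-line\<close>

lemma integral_FTC_at_least_zero:
  fixes f F :: "real \<Rightarrow> real"
  assumes "\<And>t. t \<ge> 0 \<Longrightarrow> (F has_real_derivative f t) (at t)"
    and "set_integrable lborel {0..} f" and "(F \<longlongrightarrow> 0) at_top" and "continuous_on {0..} f"
  shows "(LINT t:{0..}|lborel. f t) = - F 0"
proof (rule tendsto_unique)
  show "((\<lambda>b. LINT t:{0..b}|lborel. f t) \<longlongrightarrow> (LINT t:{0..}|lborel. f t)) at_top"
    by (rule tendsto_set_lebesgue_integral_at_top) (use assms in auto)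
  have "eventually (\<lambda>b. F b - F 0 = (LINT t:{0..b}|lborel. f t)) at_top"
    using eventually_ge_at_top[of 0]
  proof eventually_elim
    case (elim b)
    have "continuous_on {0..b} f" using assms(4) by (rule continuous_on_subset) auto
    then have "(\<integral>t. indicator {0..b} t *\<^sub>R f t \<partial>lborel) = F b - F 0"
      using elim assms(1)
      by (intro integral_FTC_Icc)
         (auto intro: has_field_derivative_at_within simp flip: has_real_derivative_iff_has_vector_derivative)
    then show ?case by (simp add: set_lebesgue_integral_def)
  qed
  moreover have "((\<lambda>b. F b - F 0) \<longlongrightarrow> 0 - F 0) at_top"
    using assms(3) by (intro tendsto_intros)
  ultimately show "((\<lambda>b. LINT t:{0..b}|lborel. f t) \<longlongrightarrow> - F 0) at_top"
    by (simp add: filterlim_cong)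
qed auto

text \<open>The model integral for the decay: taken with \<open>c\<close> equal to the squared
  bracket of n, it converts time decay into spatial decay.\<close>

lemma powr_shift_integral:
  fixes c q :: real
  assumes "c > 0" "q > 1"
  shows "set_integrable lborel {0..} (\<lambda>t. (c + t) powr (- q))"
    and "(LINT t:{0..}|lborel. (c + t) powr (- q)) = c powr (1 - q) / (q - 1)"
proof -
  define F where "F t = - ((c + t) powr (1 - q) / (q - 1))" for t
  have lim: "(F \<longlongrightarrow> 0) at_top"
  proof -
    have "((\<lambda>t. (c + t) powr (1 - q)) \<longlongrightarrow> 0) at_top"
      using assms by (intro tendsto_neg_powr filterlim_tendsto_add_at_top[OF tendsto_const] filterlim_ident) auto
    from tendsto_mult_left[OF this, of "- 1 / (q - 1)"] show ?thesis by (simp add: F_def[abs_def])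
  qed
  have D: "(F has_real_derivative (c + t) powr (- q)) (at t)" if "t \<ge> 0" for t
  proof -
    have "((\<lambda>t. (c + t) powr (1 - q)) has_real_derivative (1 - q) * (c + t) powr (- q)) (at t)"
      using assms that by (auto intro!: derivative_eq_intros)
    from DERIV_cmult[OF this, of "- 1 / (q - 1)"]
    have "(F has_real_derivative - 1 / (q - 1) * ((1 - q) * (c + t) powr (- q))) (at t)"
      by (simp add: F_def[abs_def])
    also have "- 1 / (q - 1) * ((1 - q) * (c + t) powr (- q)) = (c + t) powr (- q)"
      using assms by (simp add: divide_simps) (simp add: algebra_simps)
    finally show ?thesis .
  qed
  have "(\<integral>\<^sup>+ t. ennreal ((c + t) powr (- q)) * indicator {0..} t \<partial>lborel) = ennreal (0 - F 0)"
    by (rule nn_integral_FTC_atLeast) (use D lim in auto)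
  then have "has_bochner_integral lborel (\<lambda>t. (c + t) powr (- q) * indicator {0..} t) (0 - F 0)"
    using assms by (intro has_bochner_integral_nn_integral)
      (auto simp: F_def ennreal_mult' ennreal_indicator)
  then have *: "has_bochner_integral lborel (\<lambda>t. indicator {0..} t *\<^sub>R (c + t) powr (- q)) (c powr (1 - q) / (q - 1))"
    by (simp add: mult.commute F_def)
  show "set_integrable lborel {0..} (\<lambda>t. (c + t) powr (- q))"
    using * by (simp add: set_integrable_def has_bochner_integral_iff)
  show "(LINT t:{0..}|lborel. (c + t) powr (- q)) = c powr (1 - q) / (q - 1)"
    using * by (simp add: set_lebesgue_integral_def has_bochner_integral_iff)
qed

lemma set_integrable_dominated:
  fixes f g :: "real \<Rightarrow> real"
  assumes "set_integrable lborel {0..} g" "continuous_on {0..} f" "\<And>t. t \<ge> 0 \<Longrightarrow> \<bar>f t\<bar> \<le> g t"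
  shows "set_integrable lborel {0..} f"
proof (rule set_integrable_bound[OF assms(1)])
  show "set_borel_measurable lborel {0..} f"
    unfolding set_borel_measurable_def
    using borel_measurable_continuous_on_indicator[of "{0..}" f] assms(2) by simp
qed (use assms(3) in \<open>auto intro: order.trans[OF _ abs_ge_self]\<close>)

lemma set_integral_abs_dominated:
  fixes f g :: "real \<Rightarrow> real"
  assumes "set_integrable lborel {0..} g" "continuous_on {0..} f" "\<And>t. t \<ge> 0 \<Longrightarrow> \<bar>f t\<bar> \<le> g t"
  shows "\<bar>LINT t:{0..}|lborel. f t\<bar> \<le> (LINT t:{0..}|lborel. g t)"
proof -
  have "\<bar>LINT t:{0..}|lborel. f t\<bar> \<le> (LINT t:{0..}|lborel. \<bar>f t\<bar>)"
    using set_integral_norm_bound[OF set_integrable_dominated[OF assms]] by simp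
  also have "\<dots> \<le> (LINT t:{0..}|lborel. g t)"
    by (rule set_integral_mono[OF set_integrable_abs[OF set_integrable_dominated[OF assms]] assms(1)])
       (use assms(3) in auto)
  finally show ?thesis .
qed

section \<open>The differenced Green function on the lattice\<close>

text \<open>\<open>k j\<close> is the order of the difference in coordinate j. The final choice is N
  in one coordinate and 0 in the others.\<close>

definition lattice_heat :: "('d::finite \<Rightarrow> nat) \<Rightarrow> real \<Rightarrow> int ^ 'd \<Rightarrow> real" where
  "lattice_heat k t n = (\<Prod>j\<in>UNIV. heat_diff (k j) t (n $ j))"

definition lattice_green :: "('d::finite \<Rightarrow> nat) \<Rightarrow> int ^ 'd \<Rightarrow> real" where
  "lattice_green k n = (LINT t:{0..}|lborel. lattice_heat k t n)"

lemma continuous_on_lattice_heat [continuous_intros]: "continuous_on A (\<lambda>t. lattice_heat k t n)"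
  unfolding lattice_heat_def by (intro continuous_intros)

text \<open>The product rule: each coordinate contributes its one-dimensional second difference,
  with the remaining factors as spectators.\<close>

lemma lattice_heat_has_derivative:
  fixes n :: "int ^ 'd::finite"
  shows "((\<lambda>t. lattice_heat k t n) has_real_derivative
    (\<Sum>j\<in>UNIV. lattice_heat k t (n + axis j 1) + lattice_heat k t (n - axis j 1))
      - 2 * CARD('d) * lattice_heat k t n) (at t)"
proof -
  have "((\<lambda>t. lattice_heat k t n) has_real_derivative
      (\<Sum>j\<in>UNIV. (heat_diff (k j) t (n $ j + 1) + heat_diff (k j) t (n $ j - 1)
        - 2 * heat_diff (k j) t (n $ j)) * (\<Prod>i\<in>UNIV - {j}. heat_diff (k i) t (n $ i)))) (at t)"
    unfolding lattice_heat_def by (rule has_field_derivative_prod[OF heat_diff_has_derivative])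
  moreover have split: "lattice_heat k t n'
      = heat_diff (k j) t (n' $ j) * (\<Prod>i\<in>UNIV - {j}. heat_diff (k i) t (n' $ i))" for n' j
    unfolding lattice_heat_def by (rule prod.remove) auto
  have "lattice_heat k t (n + axis j 1)
      = heat_diff (k j) t (n $ j + 1) * (\<Prod>i\<in>UNIV - {j}. heat_diff (k i) t (n $ i))" for j
    unfolding split[of _ j] by (intro arg_cong2[of _ _ _ _ "(*)"] prod.cong) (auto simp: axis_def)
  moreover have "lattice_heat k t (n - axis j 1)
      = heat_diff (k j) t (n $ j - 1) * (\<Prod>i\<in>UNIV - {j}. heat_diff (k i) t (n $ i))" for j
    unfolding split[of _ j] by (intro arg_cong2[of _ _ _ _ "(*)"] prod.cong) (auto simp: axis_def)
  moreover have "2 * CARD('d) * lattice_heat k t n = (\<Sum>j\<in>(UNIV :: 'd set). 2 * lattice_heat k t n)"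
    by simp
  ultimately show ?thesis
    by (simp only: sum_subtractf[symmetric] split[of n])
       (simp add: algebra_simps flip: split[of n])
qed

section \<open>Space-time bounds, decay and the equation for the Green function\<close>

lemma lattice_norm_le_sum_abs: "lattice_norm n \<le> (\<Sum>j\<in>UNIV. real_of_int \<bar>n $ j\<bar>)"
  using L2_set_le_sum_abs[of "\<lambda>j. real_of_int (n $ j)" UNIV]
  by (simp add: lattice_norm_def L2_set_def)

text \<open>With x = R / sqrt s one has sqrt (s + R^2) <= sqrt s (1 + x), and (1 + x)^M is absorbed
  by the exponential. The result depends on s + R^2 alone, so it can be integrated over s
  exactly.\<close>

lemma exp_decay_le_powr:
  fixes s R :: real
  assumes "s > 0" "R \<ge> 0"
  shows "(1 / sqrt s) ^ M * exp (- (1 / sqrt s) * R) \<le> fact M * exp 1 * (s + R\<^sup>2) powr (- (M / 2))"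
proof -
  define x where "x = (1 / sqrt s) * R"
  have x: "x \<ge> 0" using assms by (simp add: x_def)
  have "(s + R\<^sup>2) powr (M / 2) = sqrt (s + R\<^sup>2) ^ M"
    using assms by (simp add: powr_half_sqrt[symmetric] powr_power add_nonneg_eq_0_iff)
  also have "\<dots> \<le> (sqrt s * (1 + x)) ^ M"
    using assms sqrt_add_le_add_sqrt[of s "R\<^sup>2"] by (intro power_mono) (auto simp: x_def distrib_left)
  also have "\<dots> = sqrt s ^ M * (1 + x) ^ M" by (rule power_mult_distrib)
  also have "\<dots> \<le> sqrt s ^ M * (fact M * exp (1 + x))"
    using x assms by (intro mult_left_mono power_le_fact_exp) auto
  finally have "(s + R\<^sup>2) powr (M / 2) \<le> sqrt s ^ M * fact M * exp 1 * exp x"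
    by (simp add: exp_add)
  moreover have "s + R\<^sup>2 \<noteq> 0"
    using assms by (simp add: add_nonneg_eq_0_iff)
  ultimately have "(1 / sqrt s) ^ M * exp (- x) \<le> fact M * exp 1 * (s + R\<^sup>2) powr (- (M / 2))"
    using assms unfolding powr_minus
    by (simp add: power_divide exp_minus divide_simps mult_ac)
  then show ?thesis by (simp add: x_def)
qed

text \<open>The one-dimensional bounds are multiplied: the powers of 1 / sqrt (1 + t) add up, and
  the exponents sum to the l^1 norm, which dominates the Euclidean one.\<close>

lemma lattice_heat_bound:
  obtains C where "C > 0" "\<And>t (n :: int ^ 'd::finite). t \<ge> 0 \<Longrightarrow>
    \<bar>lattice_heat k t n\<bar> \<le> C * (1 + t + (lattice_norm n)\<^sup>2) powr (- (real (\<Sum>j\<in>UNIV. Suc (k j)) / 2))"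
proof -
  have "\<exists>C>0. \<forall>t\<ge>0. \<forall>m. \<bar>heat_diff (k j) t m\<bar>
      \<le> C * (1 / sqrt (1 + t)) ^ Suc (k j) * exp (- (1 / sqrt (1 + t)) * \<bar>m\<bar>)" for j
    using heat_diff_bound[of "k j"] by metis
  then obtain C where C: "\<And>j. C j > 0" "\<And>j t m. t \<ge> 0 \<Longrightarrow> \<bar>heat_diff (k j) t m\<bar>
      \<le> C j * (1 / sqrt (1 + t)) ^ Suc (k j) * exp (- (1 / sqrt (1 + t)) * \<bar>m\<bar>)"
    by metis
  define M where "M = (\<Sum>j\<in>UNIV. Suc (k j))"
  have Cpos: "(\<Prod>j\<in>UNIV. C j) > 0" using C(1) by (intro prod_pos) auto
  show ?thesis
  proof
    show "(\<Prod>j\<in>UNIV. C j) * (fact M * exp 1) > 0" using Cpos by simp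
    fix t :: real and n :: "int ^ 'd" assume t: "t \<ge> 0"
    define a where "a = 1 / sqrt (1 + t)"
    have a: "a > 0" using t by (simp add: a_def)
    have "\<bar>lattice_heat k t n\<bar> = (\<Prod>j\<in>UNIV. \<bar>heat_diff (k j) t (n $ j)\<bar>)"
      by (simp add: lattice_heat_def abs_prod)
    also have "\<dots> \<le> (\<Prod>j\<in>UNIV. C j * a ^ Suc (k j) * exp (- a * \<bar>n $ j\<bar>))"
      unfolding a_def using C(2)[OF t] by (intro prod_mono) auto
    also have "\<dots> = (\<Prod>j\<in>UNIV. C j) * a ^ M * exp (- a * (\<Sum>j\<in>UNIV. \<bar>n $ j\<bar>))"
      by (simp add: prod.distrib power_sum M_def exp_sum sum_distrib_left flip: sum_negf)
    also have "\<dots> \<le> (\<Prod>j\<in>UNIV. C j) * a ^ M * exp (- a * lattice_norm n)"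
      using Cpos a lattice_norm_le_sum_abs[of n] by (intro mult_left_mono) auto
    also have "\<dots> = (\<Prod>j\<in>UNIV. C j) * (a ^ M * exp (- a * lattice_norm n))"
      by simp
    also have "\<dots> \<le> (\<Prod>j\<in>UNIV. C j) * (fact M * exp 1 * (1 + t + (lattice_norm n)\<^sup>2) powr (- (M / 2)))"
      using Cpos t unfolding a_def
      by (intro mult_left_mono exp_decay_le_powr) (auto simp: lattice_norm_def sum_nonneg)
    finally show "\<bar>lattice_heat k t n\<bar> \<le> (\<Prod>j\<in>UNIV. C j) * (fact M * exp 1)
        * (1 + t + (lattice_norm n)\<^sup>2) powr (- (real (\<Sum>j\<in>UNIV. Suc (k j)) / 2))"
      by (simp add: M_def mult_ac)
  qed
qed

lemma lattice_heat_integrable: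
  assumes "(\<Sum>j\<in>UNIV. Suc (k j)) > 2"
  shows "set_integrable lborel {0..} (\<lambda>t. lattice_heat k t n)"
proof -
  obtain C where C: "\<And>t. t \<ge> 0 \<Longrightarrow> \<bar>lattice_heat k t n\<bar>
      \<le> C * (1 + t + (lattice_norm n)\<^sup>2) powr (- (real (\<Sum>j\<in>UNIV. Suc (k j)) / 2))"
    using lattice_heat_bound[of k] by metis
  have "real (\<Sum>j\<in>UNIV. Suc (k j)) > 2"
    using assms by (metis of_nat_less_iff of_nat_numeral)
  show ?thesis
  proof (rule set_integrable_dominated)
    show "set_integrable lborel {0..} (\<lambda>t. C * (1 + (lattice_norm n)\<^sup>2 + t)
        powr (- (real (\<Sum>j\<in>UNIV. Suc (k j)) / 2)))"
      using \<open>real (\<Sum>j\<in>UNIV. Suc (k j)) > 2\<close>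
      by (intro set_integrable_mult_right powr_shift_integral(1)) (simp_all add: add_pos_nonneg del: of_nat_sum)
  qed (use C in \<open>auto intro: continuous_intros simp: add_ac\<close>)
qed

lemma bracket_power2: "(bracket n)\<^sup>2 = 1 + (lattice_norm n)\<^sup>2"
  by (simp add: bracket_def add_nonneg_nonneg)

text \<open>Writing b for the bracket of n and M for the sum of the \<open>Suc (k j)\<close>, the
  integrand is bounded by a multiple of (b^2 + t)^(-M/2), whose integral is proportional to b^(2 -
  M).\<close>

lemma lattice_green_decay:
  assumes "(\<Sum>j\<in>UNIV. Suc (k j)) > 2"
  obtains C where "C > 0" "\<And>n :: int ^ 'd::finite.
    \<bar>lattice_green k n\<bar> \<le> C * bracket n powr (2 - real (\<Sum>j\<in>UNIV. Suc (k j)))"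
proof -
  define M where "M = (\<Sum>j\<in>UNIV. Suc (k j))"
  have M: "M > 2" using assms by (simp add: M_def)
  obtain C where C: "C > 0" "\<And>t (n :: int ^ 'd). t \<ge> 0 \<Longrightarrow> \<bar>lattice_heat k t n\<bar>
      \<le> C * (1 + t + (lattice_norm n)\<^sup>2) powr (- (real M / 2))"
    unfolding M_def using lattice_heat_bound[of k] by metis
  show ?thesis
  proof
    show "C / (real M / 2 - 1) > 0" using C M by simp
    fix n :: "int ^ 'd"
    define b where "b = bracket n"
    have b: "b > 0" by (simp add: b_def bracket_def add_pos_nonneg)
    have b2: "1 + (lattice_norm n)\<^sup>2 = b\<^sup>2" by (simp add: b_def bracket_power2)
    note I = powr_shift_integral[of "b\<^sup>2" "real M / 2"]
    have "\<bar>lattice_green k n\<bar> \<le> (LINT t:{0..}|lborel. C * (b\<^sup>2 + t) powr (- (real M / 2)))"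
      unfolding lattice_green_def
    proof (rule set_integral_abs_dominated)
      show "set_integrable lborel {0..} (\<lambda>t. C * (b\<^sup>2 + t) powr (- (real M / 2)))"
        using b M by (intro set_integrable_mult_right I) auto
      show "\<bar>lattice_heat k t n\<bar> \<le> C * (b\<^sup>2 + t) powr (- (real M / 2))" if "t \<ge> 0" for t
        using C(2)[OF that, of n] by (simp add: b2[symmetric] add_ac)
    qed (intro continuous_intros)
    also have "\<dots> = C * ((b\<^sup>2) powr (1 - real M / 2) / (real M / 2 - 1))"
      using b M by (simp add: I)
    also have "(b\<^sup>2) powr (1 - real M / 2) = b powr (2 - real M)"
      using b by (simp add: powr_powr flip: powr_numeral)
    finally show "\<bar>lattice_green k n\<bar>
        \<le> C / (real M / 2 - 1) * bracket n powr (2 - real (\<Sum>j\<in>UNIV. Suc (k j)))"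
      by (simp add: M_def b_def)
  qed
qed

text \<open>The heat equation is integrated over all times; the heat function vanishes as t tends to
  infinity, so only its initial value remains.\<close>

lemma lattice_green_equation:
  fixes n :: "int ^ 'd::finite"
  assumes "(\<Sum>j\<in>UNIV. Suc (k j)) > 2"
  shows "(\<Sum>j\<in>UNIV. lattice_green k (n + axis j 1) + lattice_green k (n - axis j 1))
    - 2 * CARD('d) * lattice_green k n = - lattice_heat k 0 n"
proof -
  define f where "f t = (\<Sum>j\<in>UNIV. lattice_heat k t (n + axis j 1) + lattice_heat k t (n - axis j 1))
      - 2 * CARD('d) * lattice_heat k t n" for t
  note I = lattice_heat_integrable[OF assms]
  have I_sum: "set_integrable lborel {0..} (\<lambda>t. lattice_heat k t (n + axis j 1) + lattice_heat k t (n - axis j 1))"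
    for j by (rule set_integral_add(1)[OF I I])
  have I_tot: "set_integrable lborel {0..} (\<lambda>t. \<Sum>j\<in>UNIV. lattice_heat k t (n + axis j 1) + lattice_heat k t (n - axis j 1))"
    using I_sum unfolding set_integrable_def scaleR_sum_right by (intro Bochner_Integration.integrable_sum)
  have I_n: "set_integrable lborel {0..} (\<lambda>t. 2 * CARD('d) * lattice_heat k t n)"
    using I by (intro set_integrable_mult_right) auto
  have "(LINT t:{0..}|lborel. f t) = - lattice_heat k 0 n"
  proof (rule integral_FTC_at_least_zero)
    show "((\<lambda>t. lattice_heat k t n) has_real_derivative f t) (at t)" for t
      unfolding f_def by (rule lattice_heat_has_derivative)
    show "set_integrable lborel {0..} f"
      unfolding f_def by (rule set_integral_diff(1)[OF I_tot I_n])
    show "continuous_on {0..} f"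
      unfolding f_def by (intro continuous_intros)
    obtain C where C: "\<And>t. t \<ge> 0 \<Longrightarrow> \<bar>lattice_heat k t n\<bar>
        \<le> C * (1 + t + (lattice_norm n)\<^sup>2) powr (- (real (\<Sum>j\<in>UNIV. Suc (k j)) / 2))"
      using lattice_heat_bound[of k] by metis
    show "((\<lambda>t. lattice_heat k t n) \<longlongrightarrow> 0) at_top"
    proof (rule Lim_null_comparison)
      show "\<forall>\<^sub>F t in at_top. norm (lattice_heat k t n)
          \<le> C * ((1 + (lattice_norm n)\<^sup>2) + t) powr (- (real (\<Sum>j\<in>UNIV. Suc (k j)) / 2))"
        using eventually_ge_at_top[of 0] by eventually_elim (use C in \<open>simp add: add_ac\<close>)
      have "((\<lambda>t. ((1 + (lattice_norm n)\<^sup>2) + t) powr (- (real (\<Sum>j\<in>UNIV. Suc (k j)) / 2))) \<longlongrightarrow> 0) at_top"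
        using assms of_nat_less_iff[of 2 "\<Sum>j\<in>UNIV. Suc (k j)", where 'a = real]
        by (intro tendsto_neg_powr filterlim_tendsto_add_at_top[OF tendsto_const] filterlim_ident) linarith
      then show "((\<lambda>t. C * ((1 + (lattice_norm n)\<^sup>2) + t) powr (- (real (\<Sum>j\<in>UNIV. Suc (k j)) / 2))) \<longlongrightarrow> 0) at_top"
        by (rule tendsto_mult_right_zero)
    qed
  qed
  moreover have "(LINT t:{0..}|lborel. f t)
      = (LINT t:{0..}|lborel. \<Sum>j\<in>UNIV. lattice_heat k t (n + axis j 1) + lattice_heat k t (n - axis j 1))
        - (LINT t:{0..}|lborel. 2 * CARD('d) * lattice_heat k t n)"
    unfolding f_def by (rule set_integral_diff(2)[OF I_tot I_n])
  moreover have "(LINT t:{0..}|lborel. \<Sum>j\<in>UNIV. lattice_heat k t (n + axis j 1) + lattice_heat k t (n - axis j 1))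
      = (\<Sum>j\<in>UNIV. LINT t:{0..}|lborel. lattice_heat k t (n + axis j 1) + lattice_heat k t (n - axis j 1))"
    using I_sum unfolding set_integrable_def set_lebesgue_integral_def scaleR_sum_right
    by (intro Bochner_Integration.integral_sum)
  ultimately show ?thesis
    by (simp add: set_integral_add(2)[OF I I] lattice_green_def)
qed

section \<open>Signs on the line of sites\<close>

text \<open>At s = 0 and e = d - 1 this is the Green function at the m-th site of the distinguished
  axis. The Laplace parameter s and the free exponent e allow an induction on the number of
  transverse coordinates.\<close>

definition weighted_diff :: "nat \<Rightarrow> nat \<Rightarrow> real \<Rightarrow> int \<Rightarrow> real" where
  "weighted_diff N e s m =
     (LINT t:{0..}|lborel. heat_diff N t m * (exp (- s * t) * heat_kernel t 0 ^ e))"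

lemma continuous_on_heat_kernel [continuous_intros]: "continuous_on A (\<lambda>t. heat_kernel t m)"
  using continuous_on_heat_diff[of A 0 m] by simp

lemma heat_diff_measurable [measurable]: "(\<lambda>t. heat_diff N t m) \<in> borel_measurable borel"
  by (intro borel_measurable_continuous_onI continuous_intros)

lemma heat_kernel_measurable [measurable]: "(\<lambda>t. heat_kernel t m) \<in> borel_measurable borel"
  by (intro borel_measurable_continuous_onI continuous_intros)

lemma heat_diff_sup_bound:
  obtains C where "C > 0" "\<And>t m. t \<ge> 0 \<Longrightarrow> \<bar>heat_diff N t m\<bar> \<le> C * (1 / sqrt (1 + t)) ^ Suc N"
proof -
  obtain C where C: "C > 0" "\<And>t m. t \<ge> 0 \<Longrightarrow>
      \<bar>heat_diff N t m\<bar> \<le> C * (1 / sqrt (1 + t)) ^ Suc N * exp (- (1 / sqrt (1 + t)) * \<bar>m\<bar>)"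
    using heat_diff_bound by metis
  have "\<bar>heat_diff N t m\<bar> \<le> C * (1 / sqrt (1 + t)) ^ Suc N" if "t \<ge> 0" for t m
  proof (rule order.trans[OF C(2)[OF that]])
    show "C * (1 / sqrt (1 + t)) ^ Suc N * exp (- (1 / sqrt (1 + t)) * \<bar>m\<bar>)
        \<le> C * (1 / sqrt (1 + t)) ^ Suc N"
      using C(1) that by (intro mult_left_le) auto
  qed
  with C(1) that show ?thesis by blast
qed

text \<open>Both the exponential and the power are kept: for s > 0 the former gives integrability,
  for s = 0 only the latter is available.\<close>

lemma weighted_diff_integrand_bound:
  obtains C where "C > 0" "\<And>s t m. t \<ge> 0 \<Longrightarrow> s \<ge> 0 \<Longrightarrow>
    \<bar>heat_diff N t m * (exp (- s * t) * heat_kernel t 0 ^ e)\<bar>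
      \<le> C * (exp (- s * t) * (1 + t) powr (- (real (N + e + 1) / 2)))"
proof -
  obtain C where C: "C > 0" "\<And>t m. t \<ge> 0 \<Longrightarrow> \<bar>heat_diff N t m\<bar> \<le> C * (1 / sqrt (1 + t)) ^ Suc N"
    using heat_diff_sup_bound by metis
  obtain C' where C': "C' > 0" "\<And>t m. t \<ge> 0 \<Longrightarrow> \<bar>heat_kernel t m\<bar> \<le> C' * (1 / sqrt (1 + t))"
    using heat_diff_sup_bound[of 0] by (metis heat_diff.simps(1) power_one_right One_nat_def)
  show ?thesis
  proof
    show "C * C' ^ e > 0" using C C' by simp
    fix s t :: real and m :: int assume t: "t \<ge> 0" and "s \<ge> 0"
    define a where "a = 1 / sqrt (1 + t)"
    have "\<bar>heat_diff N t m * (exp (- s * t) * heat_kernel t 0 ^ e)\<bar>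
        = \<bar>heat_diff N t m\<bar> * (exp (- s * t) * \<bar>heat_kernel t 0\<bar> ^ e)"
      by (simp add: abs_mult power_abs)
    also have "\<dots> \<le> (C * a ^ Suc N) * (exp (- s * t) * (C' * a) ^ e)"
      unfolding a_def using C C' t by (intro mult_mono power_mono) auto
    also have "\<dots> = C * C' ^ e * (exp (- s * t) * a ^ (N + e + 1))"
      by (simp add: power_mult_distrib power_add)
    also have "a ^ (N + e + 1) = (1 + t) powr (- (real (N + e + 1) / 2))"
    proof -
      have "a = (1 + t) powr (- (1 / 2))"
        using t by (subst powr_minus_divide, subst powr_half_sqrt) (auto simp: a_def)
      moreover have "((1 + t) powr (- (1 / 2))) ^ (N + e + 1) = (1 + t) powr (real (N + e + 1) * (- (1 / 2)))"
        using t by (intro powr_power) auto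
      ultimately have "a ^ (N + e + 1) = (1 + t) powr (real (N + e + 1) * (- (1 / 2)))"
        by (simp only:)
      then show ?thesis by (simp only: mult_minus_right times_divide_eq_right mult_1_right)
    qed
    finally show "\<bar>heat_diff N t m * (exp (- s * t) * heat_kernel t 0 ^ e)\<bar>
      \<le> C * C' ^ e * (exp (- s * t) * (1 + t) powr (- (real (N + e + 1) / 2)))" .
  qed
qed

lemma set_integrable_exp_minus:
  fixes s :: real
  assumes "s > 0"
  shows "set_integrable lborel {0..} (\<lambda>t. exp (- s * t))"
proof (rule set_integrable_dominated)
  \<comment> \<open>The dominating function is 2 e / (1 + s t)^2 rewritten in the form of the model
    integral; it comes from (1 + s t)^2 <= 2 exp (1 + s t).\<close>
  show "set_integrable lborel {0..} (\<lambda>t. fact 2 * exp 1 / s\<^sup>2 * (1 / s + t) powr (- 2))"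
    using assms by (intro set_integrable_mult_right powr_shift_integral(1)) auto
  show "\<bar>exp (- s * t)\<bar> \<le> fact 2 * exp 1 / s\<^sup>2 * (1 / s + t) powr (- 2)" if "t \<ge> 0" for t
  proof -
    have "(1 + s * t) ^ 2 \<le> fact 2 * exp (1 + s * t)"
      using assms that by (intro power_le_fact_exp) auto
    moreover have "(1 / s + t) powr (- 2) = s\<^sup>2 / (1 + s * t)\<^sup>2"
    proof -
      have "1 / s + t = (1 + s * t) / s" using assms by (simp add: field_simps)
      then have "(1 / s + t) powr (- 2) = 1 / ((1 + s * t) / s)\<^sup>2"
        using assms that by (simp add: powr_minus_divide)
      then show ?thesis by (simp add: power_divide)
    qed
    moreover have "1 + s * t > 0" using assms that by (simp add: add_pos_nonneg)
    ultimately have "exp (- s * t) \<le> fact 2 * exp 1 / (1 + s * t)\<^sup>2"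
      by (simp add: exp_minus exp_add divide_simps mult_ac)
    then show ?thesis using assms \<open>(1 / s + t) powr (- 2) = _\<close> by simp
  qed
qed (intro continuous_intros)

lemma weighted_diff_integrable:
  assumes "s \<ge> 0" "N + e \<ge> 2 \<or> s > 0"
  shows "set_integrable lborel {0..} (\<lambda>t. heat_diff N t m * (exp (- s * t) * heat_kernel t 0 ^ e))"
proof -
  obtain C where C: "C > 0" "\<And>s t m. t \<ge> 0 \<Longrightarrow> s \<ge> 0 \<Longrightarrow>
    \<bar>heat_diff N t m * (exp (- s * t) * heat_kernel t 0 ^ e)\<bar>
      \<le> C * (exp (- s * t) * (1 + t) powr (- (real (N + e + 1) / 2)))"
    using weighted_diff_integrand_bound by metis
  have cont: "continuous_on {0..} (\<lambda>t. heat_diff N t m * (exp (- s * t) * heat_kernel t 0 ^ e))"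
    by (intro continuous_intros)
  show ?thesis
  proof (cases "s > 0")
    case True
    show ?thesis
    proof (rule set_integrable_dominated[OF _ cont])
      show "set_integrable lborel {0..} (\<lambda>t. C * exp (- s * t))"
        using True by (intro set_integrable_mult_right set_integrable_exp_minus)
      show "\<bar>heat_diff N t m * (exp (- s * t) * heat_kernel t 0 ^ e)\<bar> \<le> C * exp (- s * t)"
        if "t \<ge> 0" for t
      proof (rule order.trans[OF C(2)[OF that assms(1)]], intro mult_left_mono mult_left_le)
        show "(1 + t) powr (- (real (N + e + 1) / 2)) \<le> 1"
          using that powr_mono[of "- (real (N + e + 1) / 2)" 0 "1 + t"] by simp
      qed (use C in auto)
    qed
  next
    case False
    then have Ne: "N + e \<ge> 2" using assms by auto
    show ?thesis
    proof (rule set_integrable_dominated[OF _ cont])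
      show "set_integrable lborel {0..} (\<lambda>t. C * (1 + t) powr (- (real (N + e + 1) / 2)))"
        using Ne by (intro set_integrable_mult_right powr_shift_integral(1)) auto
      show "\<bar>heat_diff N t m * (exp (- s * t) * heat_kernel t 0 ^ e)\<bar>
          \<le> C * (1 + t) powr (- (real (N + e + 1) / 2))" if "t \<ge> 0" for t
        using C(2)[OF that, of s m] False assms by simp
    qed
  qed
qed

lemma weighted_diff_Suc:
  assumes "s \<ge> 0" "N + e \<ge> 2 \<or> s > 0"
  shows "weighted_diff (Suc N) e s m = weighted_diff N e s m - weighted_diff N e s (m - 1)"
  unfolding weighted_diff_def heat_diff.simps left_diff_distrib
  by (rule set_integral_diff(2)[OF weighted_diff_integrable[OF assms] weighted_diff_integrable[OF assms]])

lemma weighted_diff_reflect: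
  "weighted_diff N e s (int N - m) = (- 1) ^ N * weighted_diff N e s m"
  unfolding weighted_diff_def heat_diff_reflect
  by (simp only: mult.assoc set_integral_mult_right)

section \<open>Laplace transform in time and positivity at the end site\<close>

lemma resolvent_equation:
  assumes "s > 0" "m \<noteq> 0"
  shows "weighted_diff 0 0 s (m + 1) + weighted_diff 0 0 s (m - 1) = (2 + s) * weighted_diff 0 0 s m"
proof -
  define F where "F m t = heat_kernel t m * exp (- s * t)" for m t
  have W: "weighted_diff 0 0 s m = (LINT t:{0..}|lborel. F m t)" for m
    by (simp add: weighted_diff_def F_def)
  have I: "set_integrable lborel {0..} (F m)" for m
    using weighted_diff_integrable[of s 0 0 m] assms by (simp add: F_def[abs_def])
  obtain C where C: "C > 0" "\<And>t m. t \<ge> 0 \<Longrightarrow> \<bar>heat_diff 0 t m\<bar> \<le> C * (1 / sqrt (1 + t)) ^ Suc 0"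
    using heat_diff_sup_bound by metis
  have "(LINT t:{0..}|lborel. (F (m + 1) t + F (m - 1) t) - (2 + s) * F m t) = - F m 0"
  proof (rule integral_FTC_at_least_zero)
    show "(F m has_real_derivative (F (m + 1) t + F (m - 1) t) - (2 + s) * F m t) (at t)" for t
      unfolding F_def
      by (auto intro!: derivative_eq_intros heat_kernel_has_derivative simp: algebra_simps)
    show "set_integrable lborel {0..} (\<lambda>t. (F (m + 1) t + F (m - 1) t) - (2 + s) * F m t)"
      by (intro set_integral_diff(1) set_integral_add(1) set_integrable_mult_right I)
    show "continuous_on {0..} (\<lambda>t. (F (m + 1) t + F (m - 1) t) - (2 + s) * F m t)"
      unfolding F_def by (intro continuous_intros)
    show "(F m \<longlongrightarrow> 0) at_top"
    proof (rule Lim_null_comparison)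
      show "\<forall>\<^sub>F t in at_top. norm (F m t) \<le> C * exp (- s * t)"
        using eventually_ge_at_top[of 0]
      proof eventually_elim
        case (elim t)
        have "\<bar>heat_kernel t m\<bar> \<le> C * (1 / sqrt (1 + t))" using C(2)[OF elim, of m] by simp
        also have "\<dots> \<le> C" using C(1) elim by (intro mult_left_le) auto
        finally show ?case by (simp add: F_def abs_mult)
      qed
      have "((\<lambda>t. exp (- s * t)) \<longlongrightarrow> 0) at_top"
        using assms(1) by (intro filterlim_compose[OF exp_at_bot] filterlim_tendsto_neg_mult_at_bot[OF tendsto_const]
            filterlim_ident) auto
      then show "((\<lambda>t. C * exp (- s * t)) \<longlongrightarrow> 0) at_top" by (rule tendsto_mult_right_zero)
    qed
  qed
  \<comment> \<open>The initial mass sits at 0, so for m different from 0 the transformed equation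
    has no source term.\<close>
  also have "F m 0 = 0" using assms by (simp add: F_def heat_kernel_at_0)
  also have "(LINT t:{0..}|lborel. (F (m + 1) t + F (m - 1) t) - (2 + s) * F m t)
      = weighted_diff 0 0 s (m + 1) + weighted_diff 0 0 s (m - 1) - (2 + s) * weighted_diff 0 0 s m"
    using I by (simp add: W set_integral_add)
  finally show ?thesis by simp
qed

text \<open>The solutions are combinations of r^k and r^(-k). The quantity w(k+1) - r w(k) removes
  the first and grows like r^(-k), so boundedness forces it to vanish.\<close>

lemma bounded_recurrence_geometric:
  fixes w :: "nat \<Rightarrow> real"
  assumes r: "0 < r" "r < 1" and rec: "\<And>k. w (Suc (Suc k)) + w k = (r + 1 / r) * w (Suc k)"
    and bdd: "\<And>k. \<bar>w k\<bar> \<le> B"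
  shows "w k = r ^ k * w 0"
proof -
  define x where "x k = w (Suc k) - r * w k" for k
  have "x (Suc k) = x k / r" for k
    using rec[of k] r by (simp add: x_def field_simps)
  then have x: "x 0 = r ^ k * x k" for k
    using r by (induction k) auto
  have "\<bar>x 0\<bar> \<le> r ^ k * (2 * B)" for k
  proof -
    have "\<bar>r * w k\<bar> \<le> 1 * B"
      unfolding abs_mult using r bdd by (intro mult_mono) auto
    then have "\<bar>x k\<bar> \<le> 2 * B" using bdd[of "Suc k"] unfolding x_def by linarith
    then show ?thesis using x[of k] r by (simp add: abs_mult)
  qed
  moreover have "(\<lambda>k. r ^ k * (2 * B)) \<longlonglongrightarrow> 0"
    using r by (intro tendsto_mult_left_zero LIMSEQ_realpow_zero) auto
  ultimately have "\<bar>x 0\<bar> \<le> 0" by (intro LIMSEQ_le_const) auto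
  then have "x k = 0" for k using x[of k] r by auto
  then show ?thesis by (induction k) (auto simp: x_def)
qed

lemma set_integral_pos:
  fixes f :: "real \<Rightarrow> real"
  assumes "set_integrable lborel A f" "emeasure lborel A > 0" "\<And>x. x \<in> A \<Longrightarrow> f x > 0"
  shows "(LINT x:A|lborel. f x) > 0"
proof -
  have "(LINT x:A|lborel. f x) \<ge> 0"
    unfolding set_lebesgue_integral_def
    by (intro Bochner_Integration.integral_nonneg) (use assms in \<open>auto simp: indicator_def intro: less_imp_le\<close>)
  moreover have "(LINT x:A|lborel. f x) \<noteq> 0"
  proof
    assume "(LINT x:A|lborel. f x) = 0"
    then have "AE x in lborel. indicator A x *\<^sub>R f x = 0"
      using assms unfolding set_lebesgue_integral_def set_integrable_def
      by (subst (asm) integral_nonneg_eq_0_iff_AE) (auto simp: indicator_def intro: less_imp_le)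
    then have "AE x in lborel. x \<notin> A"
      by eventually_elim (use assms(3) in \<open>force simp: indicator_def\<close>)
    moreover have "A \<in> sets lborel"
      using assms(2) by (intro emeasure_neq_0_sets) auto
    ultimately show False
      using assms(2) AE_iff_measurable[of A lborel "\<lambda>x. x \<notin> A"] by simp
  qed
  ultimately show ?thesis by linarith
qed

lemma weighted_diff_0_pos:
  assumes "s > 0"
  shows "weighted_diff N 0 s 0 > 0"
proof -
  define w where "w k = weighted_diff 0 0 s (int k)" for k
  have w_minus: "weighted_diff 0 0 s (- int k) = w k" for k
    by (simp add: w_def weighted_diff_def heat_kernel_uminus)
  define D where "D = sqrt (s\<^sup>2 + 4 * s)"
  \<comment> \<open>The smaller root of r + 1/r = 2 + s; the discriminant is (2 + s)^2 - 4 =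
    D^2.\<close>
  define r where "r = (2 + s - D) / 2"
  have D2: "D\<^sup>2 = s\<^sup>2 + 4 * s" using assms by (simp add: D_def)
  have "s < D" unfolding D_def using assms by (intro real_less_rsqrt) auto
  moreover have "D < 2 + s"
    unfolding D_def using assms by (intro real_less_lsqrt) (auto simp: power2_sum)
  ultimately have r: "0 < r" "r < 1" by (auto simp: r_def)
  have "r * r + 1 = (2 + s) * r"
    using D2 by (simp add: r_def power2_eq_square field_simps)
  then have r': "2 + s = r + 1 / r" using r by (simp add: field_simps)
  obtain C where C: "C > 0" "\<And>s' t m. t \<ge> 0 \<Longrightarrow> s' \<ge> 0 \<Longrightarrow>
    \<bar>heat_diff 0 t m * (exp (- s' * t) * heat_kernel t 0 ^ 0)\<bar>
      \<le> C * (exp (- s' * t) * (1 + t) powr (- (real (0 + 0 + 1) / 2)))"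
    using weighted_diff_integrand_bound[of 0 0] by metis
  have "\<bar>w k\<bar> \<le> (LINT t:{0..}|lborel. C * exp (- s * t))" for k
    unfolding w_def weighted_diff_def
  proof (rule set_integral_abs_dominated)
    show "set_integrable lborel {0..} (\<lambda>t. C * exp (- s * t))"
      using assms by (intro set_integrable_mult_right set_integrable_exp_minus)
    show "\<bar>heat_diff 0 t (int k) * (exp (- s * t) * heat_kernel t 0 ^ 0)\<bar> \<le> C * exp (- s * t)"
      if "t \<ge> 0" for t
    proof (rule order.trans[OF C(2)[OF that]], use assms in simp, intro mult_left_mono mult_left_le)
      show "(1 + t) powr (- (real (0 + 0 + 1) / 2)) \<le> 1"
        using that powr_mono[of "- (1 / 2)" 0 "1 + t"] by simp
    qed (use C in auto)
  qed (intro continuous_intros)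
  moreover have "w (Suc (Suc k)) + w k = (r + 1 / r) * w (Suc k)" for k
    using resolvent_equation[OF assms, of "int (Suc k)"] unfolding r'[symmetric] by (simp add: w_def add_ac)
  ultimately have w: "w k = r ^ k * w 0" for k
    using bounded_recurrence_geometric[OF r] by blast
  \<comment> \<open>The backward difference at -k involves only the sites -k - N, ..., -k on one
    side of the origin, where the transform is a single geometric sequence; each difference
    multiplies it by 1 - r.\<close>
  have W: "weighted_diff N 0 s (- int k) = r ^ k * (1 - r) ^ N * w 0" for k
  proof (induction N arbitrary: k)
    case 0
    show ?case using w[of k] by (simp add: w_minus)
  next
    case (Suc N)
    have shift: "- int k - 1 = - int (Suc k)" by simp
    have "weighted_diff (Suc N) 0 s (- int k)
        = weighted_diff N 0 s (- int k) - weighted_diff N 0 s (- int (Suc k))"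
      unfolding shift[symmetric] using assms by (intro weighted_diff_Suc) auto
    then show ?case unfolding Suc.IH by (simp add: algebra_simps)
  qed
  have "w 0 > 0"
    unfolding w_def weighted_diff_def
  proof (rule set_integral_pos[OF weighted_diff_integrable])
    have "emeasure lborel {0..1::real} \<le> emeasure lborel {0::real..}"
      by (intro emeasure_mono) auto
    then show "emeasure lborel {0::real..} > 0"
      by (auto intro: less_le_trans[rotated])
  qed (use assms heat_kernel_0_pos in auto)
  with W[of 0] r show ?thesis by simp
qed

text \<open>One factor q_t(0) is written as the integral of exp (- c(x) t) over x. By Fubini this
  averages \<open>weighted_diff N e\<close> over the parameters s + c(x), which are positive even
  when s = 0. The assumption N >= 1 makes the integral converge in that case.\<close>

lemma weighted_diff_step:
  assumes "N \<ge> 1" "s \<ge> 0" and pos: "\<And>s. s > 0 \<Longrightarrow> weighted_diff N e s 0 > 0"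
  shows "weighted_diff N (Suc e) s 0 > 0"
proof -
  define c where "c x = 2 * (1 - cos (2 * pi * x))" for x :: real
  define g where "g t = indicator {0..} t * (heat_diff N t 0 * (exp (- s * t) * heat_kernel t 0 ^ e))" for t :: real
  \<comment> \<open>The open interval excludes the zeros of \<open>c\<close> at 0 and 1, so
    positivity is needed only for strictly positive parameters.\<close>
  define h where "h t x = indicator {0<..<1} x * exp (- c x * t)" for t x :: real
  have [measurable]: "g \<in> borel_measurable borel" "c \<in> borel_measurable borel"
    unfolding g_def[abs_def] c_def[abs_def] by measurable
  have h_int: "integrable lborel (h t)" and h_eq: "(\<integral>x. h t x \<partial>lborel) = heat_kernel t 0" for t
  proof -
    have "(\<lambda>x. exp (- c x * t)) = (\<lambda>x. exp (- 2 * t * (1 - cos (2 * pi * x))))"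
      by (simp add: c_def fun_eq_iff algebra_simps)
    then have *: "((\<lambda>x. exp (- c x * t)) has_integral heat_kernel t 0) {0<..<1}"
      using heat_kernel_0_has_integral[of t] by (simp add: has_integral_Icc_iff_Ioo)
    have "set_integrable lborel {0..1} (\<lambda>x. exp (- c x * t))"
      unfolding c_def by (intro borel_integrable_atLeastAtMost' continuous_intros)
    then have "set_integrable lborel {0<..<1} (\<lambda>x. exp (- c x * t))"
      by (rule set_integrable_subset) auto
    with set_borel_integral_eq_integral(2)[OF this] integral_unique[OF *]
    show "integrable lborel (h t)" "(\<integral>x. h t x \<partial>lborel) = heat_kernel t 0"
      by (auto simp: h_def[abs_def] set_integrable_def set_lebesgue_integral_def)
  qed
  have gI: "integrable lborel (\<lambda>t. g t * heat_kernel t 0)"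
    using weighted_diff_integrable[of s N "Suc e" 0] assms(1,2)
    by (simp add: g_def set_integrable_def mult_ac)
  have f_int: "integrable (lborel \<Otimes>\<^sub>M lborel) (\<lambda>(t, x). g t * h t x)"
  proof (rule lborel_pair.Fubini_integrable)
    show "(\<lambda>(t, x). g t * h t x) \<in> borel_measurable (lborel \<Otimes>\<^sub>M lborel)"
      unfolding h_def by measurable
    have "(\<integral>x. norm (case (t, x) of (t, x) \<Rightarrow> g t * h t x) \<partial>lborel) = \<bar>g t * heat_kernel t 0\<bar>" for t
      using h_eq[of t] heat_kernel_0_pos[of t] by (simp add: abs_mult h_def)
    then show "integrable lborel (\<lambda>t. \<integral>x. norm (case (t, x) of (t, x) \<Rightarrow> g t * h t x) \<partial>lborel)"
      using gI by (simp only: integrable_abs)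
  qed (use h_int in auto)
  have inner: "(\<integral>t. g t * h t x \<partial>lborel) = indicator {0<..<1} x * weighted_diff N e (s + c x) 0" for x
  proof -
    have "(\<lambda>t. g t * h t x) = (\<lambda>t. indicator {0<..<1} x *
        (indicator {0..} t * (heat_diff N t 0 * (exp (- (s + c x) * t) * heat_kernel t 0 ^ e))))"
      by (auto simp: g_def h_def fun_eq_iff exp_add[symmetric] algebra_simps split: split_indicator)
    then show ?thesis by (simp add: weighted_diff_def set_lebesgue_integral_def)
  qed
  have "weighted_diff N (Suc e) s 0 = (\<integral>t. g t * heat_kernel t 0 \<partial>lborel)"
    by (simp add: weighted_diff_def set_lebesgue_integral_def g_def mult_ac)
  also have "\<dots> = (\<integral>t. \<integral>x. g t * h t x \<partial>lborel \<partial>lborel)"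
    by (simp add: h_eq)
  also have "\<dots> = (\<integral>x. \<integral>t. g t * h t x \<partial>lborel \<partial>lborel)"
    by (rule lborel_pair.Fubini_integral[symmetric]) (rule f_int)
  also have "\<dots> = (LINT x:{0<..<1}|lborel. weighted_diff N e (s + c x) 0)"
    by (simp add: inner set_lebesgue_integral_def)
  also have "\<dots> > 0"
  proof (rule set_integral_pos)
    have "integrable lborel (\<lambda>x. \<integral>t. g t * h t x \<partial>lborel)"
      by (rule lborel_pair.integrable_snd) (rule f_int)
    then show "set_integrable lborel {0<..<1} (\<lambda>x. weighted_diff N e (s + c x) 0)"
      by (simp add: inner set_integrable_def)
    show "weighted_diff N e (s + c x) 0 > 0" if "x \<in> {0<..<1}" for x
    proof (rule pos)
      have "sin (pi * x) > 0" using that by (intro sin_gt_zero) auto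
      moreover have "c x = 4 * (sin (pi * x))\<^sup>2"
        using cos_double_sin[of "pi * x"] by (simp add: c_def mult_ac)
      ultimately show "s + c x > 0" using assms(2) by (simp add: add_nonneg_pos)
    qed
  qed simp
  finally show ?thesis .
qed

lemma weighted_diff_pos:
  assumes "N \<ge> 1" "s > 0"
  shows "weighted_diff N e s 0 > 0"
  using assms(2)
proof (induction e arbitrary: s)
  case 0
  then show ?case by (rule weighted_diff_0_pos)
next
  case (Suc e)
  then show ?case using weighted_diff_step[OF assms(1)] by auto
qed

text \<open>The signs alternate along the line, so in Pascal's rule the two subtracted neighbours
  reinforce each other at every interior site.\<close>

lemma weighted_diff_sign:
  assumes "N \<ge> 1" "e \<ge> 1" "j \<le> N"
  shows "(- 1) ^ j * weighted_diff N e 0 (int j) > 0"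
proof -
  \<comment> \<open>A single averaging step passes from s > 0 with e - 1 kernel factors to s = 0
    with e factors; this is where e >= 1 enters.\<close>
  have ends: "weighted_diff N e 0 0 > 0" if "N \<ge> 1" for N
    using weighted_diff_step[OF that, of 0 "e - 1"] weighted_diff_pos[OF that] assms(2) by simp
  have last: "(- 1) ^ N * weighted_diff N e 0 (int N) > 0" if "N \<ge> 1" for N
    using ends[OF that] weighted_diff_reflect[of N e 0 0] by simp
  show ?thesis using assms(1,3)
  proof (induction N arbitrary: j rule: dec_induct)
    case base
    then show ?case using ends[of 1] last[of 1] by (cases j) auto
  next
    case (step N)
    consider "j = 0" | "j = Suc N" | i where "j = Suc i" "Suc i \<le> N"
      using step.prems by (cases j) (auto simp: le_Suc_eq)
    then show ?case
    proof cases
      case 3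
      have "weighted_diff (Suc N) e 0 (int j) = weighted_diff N e 0 (int (Suc i)) - weighted_diff N e 0 (int i)"
        using step.hyps assms(2) 3 by (subst weighted_diff_Suc) auto
      then have "(- 1) ^ j * weighted_diff (Suc N) e 0 (int j)
          = (- 1) ^ Suc i * weighted_diff N e 0 (int (Suc i)) + (- 1) ^ i * weighted_diff N e 0 (int i)"
        unfolding 3(1) by (simp only: power_Suc right_diff_distrib)
      then show ?thesis
        using step.IH[of "Suc i"] step.IH[of i] 3 by linarith
    qed (use ends[of "Suc N"] last[of "Suc N"] in auto)
  qed
qed

section \<open>The eigenfunction\<close>

text \<open>On the distinguished axis the other d - 1 coordinates vanish, which identifies the Green
  function there with a \<open>weighted_diff\<close>.\<close>

lemma lattice_heat_axis:
  fixes i0 :: "'d::finite"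
  shows "lattice_heat (\<lambda>j. if j = i0 then N else 0) t (axis i0 m)
    = heat_diff N t m * heat_kernel t 0 ^ (CARD('d) - 1)"
proof -
  have "lattice_heat (\<lambda>j. if j = i0 then N else 0) t (axis i0 m)
      = heat_diff N t m * (\<Prod>j\<in>UNIV - {i0}. heat_kernel t 0)"
    unfolding lattice_heat_def
    by (subst prod.remove[of _ i0]) (auto simp: axis_def intro!: arg_cong2[of _ _ _ _ "(*)"] prod.cong)
  then show ?thesis by (simp add: card_Diff_singleton)
qed

lemma lattice_heat_at_0_support:
  fixes i0 :: "'d::finite"
  shows "{n. lattice_heat (\<lambda>j. if j = i0 then N else 0) 0 n \<noteq> 0} = (\<lambda>j. axis i0 (int j)) ` {..N}"
proof (intro set_eqI iffI)
  fix n assume "n \<in> {n. lattice_heat (\<lambda>j. if j = i0 then N else 0) 0 n \<noteq> 0}"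
  then have nz: "heat_diff (if j = i0 then N else 0) 0 (n $ j) \<noteq> 0" for j
    by (simp add: lattice_heat_def)
  have "n $ j = 0" if "j \<noteq> i0" for j
    using nz[of j] that by (simp add: heat_kernel_at_0 split: if_splits)
  moreover have "n $ i0 \<ge> 0" "nat (n $ i0) \<le> N"
    using nz[of i0] by (auto simp: heat_diff_at_0 not_less split: if_splits intro: ccontr)
  ultimately show "n \<in> (\<lambda>j. axis i0 (int j)) ` {..N}"
    by (intro image_eqI[of _ _ "nat (n $ i0)"]) (auto simp: vec_eq_iff axis_def)
next
  fix n assume "n \<in> (\<lambda>j. axis i0 (int j)) ` {..N}"
  then show "n \<in> {n. lattice_heat (\<lambda>j. if j = i0 then N else 0) 0 n \<noteq> 0}"
    by (auto simp: lattice_heat_axis heat_diff_at_0 heat_kernel_at_0)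
qed

lemma lattice_green_axis_nonzero:
  fixes i0 :: "'d::finite"
  assumes "CARD('d) \<ge> 2" "N \<ge> 1" "j \<le> N"
  shows "lattice_green (\<lambda>j. if j = i0 then N else 0) (axis i0 (int j)) \<noteq> 0"
proof -
  have "lattice_green (\<lambda>j. if j = i0 then N else 0) (axis i0 (int j))
      = weighted_diff N (CARD('d) - 1) 0 (int j)"
    by (simp add: lattice_green_def weighted_diff_def lattice_heat_axis)
  moreover have "CARD('d) - 1 \<ge> 1" using assms(1) by linarith
  ultimately show ?thesis
    using weighted_diff_sign[of N "CARD('d) - 1" j] assms by auto
qed

theorem theorem3:
  fixes K :: nat and lambda0 :: real
  assumes "CARD('d::finite) \<ge> 2"
    and "K \<ge> 2"
    and "lambda0 \<in> {- 2 * real CARD('d), 2 * real CARD('d)}"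
  shows "\<exists>(V :: int ^ 'd \<Rightarrow> complex) (u :: int ^ 'd \<Rightarrow> complex) (C :: real).
    finite {n. V n \<noteq> 0} \<and> card {n. V n \<noteq> 0} = K \<and>
    (\<exists>n. u n \<noteq> 0) \<and>
    C > 0 \<and>
    (\<forall>n. adjacency u n + mult_op V u n = complex_of_real lambda0 * u n) \<and>
    (\<forall>n. cmod (u n) \<le> C * bracket n powr (- (real CARD('d) + real K - 3)))"
proof -
  define N where "N = K - 1"
  have N: "N \<ge> 1" "K = Suc N" using assms(2) by (auto simp: N_def)
  define i0 :: 'd where "i0 = undefined"
  define k where "k = (\<lambda>j. if j = i0 then N else 0)"
  define U where "U = lattice_green k"
  define F where "F = lattice_heat k 0"
  define \<sigma> :: real where "\<sigma> = sgn lambda0"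
  \<comment> \<open>For lambda0 = 2d the factor is constant; for lambda0 = -2d it is the
    checkerboard sign, which conjugates the adjacency operator to its negative.\<close>
  define \<epsilon> :: "int ^ 'd \<Rightarrow> real"
    where "\<epsilon> n = (if \<sigma> = 1 \<or> even (\<Sum>i\<in>UNIV. n $ i) then 1 else - 1)" for n
  have \<sigma>: "\<sigma> = 1 \<or> \<sigma> = - 1" "lambda0 = \<sigma> * (2 * CARD('d))"
    using assms(1,3) by (auto simp: \<sigma>_def sgn_if)
  have sum_k: "(\<Sum>j\<in>UNIV. Suc (k j)) = CARD('d) + N"
    by (simp only: Suc_eq_plus1_left sum.distrib) (simp add: k_def)
  then have big: "(\<Sum>j\<in>UNIV. Suc (k j)) > 2" using assms(1) N by simp
  have supp: "{n. F n \<noteq> 0} = (\<lambda>j. axis i0 (int j)) ` {..N}"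
    unfolding F_def k_def by (rule lattice_heat_at_0_support)
  have U_supp: "U n \<noteq> 0" if "F n \<noteq> 0" for n
  proof -
    from that supp obtain j where "j \<le> N" "n = axis i0 (int j)" by auto
    then show ?thesis
      unfolding U_def k_def using lattice_green_axis_nonzero[OF assms(1) N(1)] by simp
  qed
  \<comment> \<open>The factor \<sigma> matches the sign of the source after conjugation. Off the
    support F n = 0, so V n = 0 even where U n might vanish.\<close>
  define V where "V n = complex_of_real (\<sigma> * F n / U n)" for n
  define u where "u n = complex_of_real (\<epsilon> n * U n)" for n
  have V_supp: "{n. V n \<noteq> 0} = (\<lambda>j. axis i0 (int j)) ` {..N}"
    using \<sigma>(1) U_supp unfolding supp[symmetric] by (auto simp: V_def)
  have inj: "inj_on (\<lambda>j. axis i0 (int j)) {..N}"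
    by (auto simp: inj_on_def axis_eq_axis)
  have sum_axis: "(\<Sum>i\<in>UNIV. axis j (1 :: int) $ i) = 1" for j :: 'd
    by (simp add: axis_def)
  \<comment> \<open>A unit step changes the parity of the coordinate sum.\<close>
  have \<epsilon>: "\<epsilon> (n + axis j 1) = \<sigma> * \<epsilon> n" "\<epsilon> (n - axis j 1) = \<sigma> * \<epsilon> n" for n j
    using \<sigma>(1) by (auto simp: \<epsilon>_def sum.distrib sum_subtractf sum_axis)
  have eq: "adjacency u n + mult_op V u n = complex_of_real lambda0 * u n" for n
  proof -
    have "adjacency u n = complex_of_real (\<Sum>j\<in>UNIV. \<sigma> * \<epsilon> n * (U (n + axis j 1) + U (n - axis j 1)))"
      by (simp add: adjacency_def u_def \<epsilon> distrib_left)
    also have "\<dots> = complex_of_real (\<sigma> * \<epsilon> n * (2 * CARD('d) * U n - F n))"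
    proof -
      have "(\<Sum>j\<in>UNIV. U (n + axis j 1) + U (n - axis j 1)) = 2 * CARD('d) * U n - F n"
        using lattice_green_equation[OF big, of n] unfolding U_def F_def by linarith
      then show ?thesis by (simp only: sum_distrib_left[symmetric])
    qed
    finally have "adjacency u n = complex_of_real (\<sigma> * \<epsilon> n * (2 * CARD('d) * U n - F n))" .
    moreover have "mult_op V u n = complex_of_real (\<sigma> * \<epsilon> n * F n)"
      using U_supp[of n] by (cases "F n = 0") (auto simp: mult_op_def V_def u_def)
    ultimately show ?thesis
      by (simp add: u_def \<sigma>(2) algebra_simps)
  qed
  obtain C where C: "C > 0" "\<And>n :: int ^ 'd. \<bar>U n\<bar> \<le> C * bracket n powr (2 - real (\<Sum>j\<in>UNIV. Suc (k j)))"
    unfolding U_def using lattice_green_decay[OF big] by metis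
  \<comment> \<open>Here N = K - 1, so 2 - (d + N) is the required exponent.\<close>
  have "2 - real (\<Sum>j\<in>UNIV. Suc (k j)) = - (real CARD('d) + real K - 3)"
    unfolding sum_k N(2) by simp
  moreover have "cmod (u n) = \<bar>U n\<bar>" for n
    by (simp add: u_def \<epsilon>_def)
  ultimately have "cmod (u n) \<le> C * bracket n powr (- (real CARD('d) + real K - 3))" for n
    using C(2)[of n] by (simp only:)
  moreover have "u (axis i0 (int 0)) \<noteq> 0"
  proof -
    have "axis i0 (int 0) \<in> {n. F n \<noteq> 0}" unfolding supp by blast
    then show ?thesis using U_supp by (simp add: u_def \<epsilon>_def)
  qed
  ultimately show ?thesis
    using C(1) eq V_supp inj N(2)
    by (intro exI[of _ V] exI[of _ u] exI[of _ C]) (auto simp: card_image)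
qed

end
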